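(* Let $(M,\varphi,\xi,\eta,g,\varepsilon,a,b,c)$ be an Einstein-like $(\varepsilon)$-para Sasakian manifold, let $\mu$ be a real constant, and set $\alpha:=\frac12\mathcal{L}_\xi g+S+\mu\,\eta\otimes\eta$. Then $\alpha$ is parallel ($\nabla\alpha=0$) if and only if $(g,\xi,\lambda,\mu)$ with $\lambda=-(a+\varepsilon(c+\mu))$ is an $\eta$-Ricci soliton on $M$.
   Context: An $(\varepsilon)$-almost paracontact metric structure $(\varphi,\xi,\eta,g,\varepsilon)$ on an $n$-dimensional manifold $M$ consists of a $(1,1)$-tensor field $\varphi$, a vector field $\xi$, a $1$-form $\eta$, a pseudo-Riemannian metric $g$ and $\varepsilon\in\{1,-1\}$ with $\varphi^2=I-\eta\otimes\xi$, $\eta(\xi)=1$, $\varphi\xi=0$, $\eta\circ\varphi=0$ and $g(\varphi X,\varphi Y)=g(X,Y)-\varepsilon\eta(X)\eta(Y)$ for all vector fields $X,Y$. (Consequently $g(X,\xi)=\varepsilon\eta(X)$ and $g(\varphi X,Y)=g(X,\varphi Y)$.) It is $(\varepsilon)$-para Sasakian if $(\nabla_X\varphi)Y=-g(\varphi X,\varphi Y)\xi-\varepsilon\eta(Y)\varphi^2X$ for all $X,Y$, where $\nabla$ is the Levi-Civita connection of $g$; in that case one has $\nabla_X\xi=\varepsilon\varphi X$ and $R(X,Y)\xi=\eta(X)Y-\eta(Y)X$. $S$ is the Ricci tensor, with conventions $R(X,Y)Z=\nabla_X\nabla_YZ-\nabla_Y\nabla_XZ-\nabla_{[X,Y]}Z$,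 $S(Y,Z)=\mathrm{trace}(X\mapsto R(X,Y)Z)$. It is Einstein-like, written $(M,\varphi,\xi,\eta,g,\varepsilon,a,b,c)$, if $a,b,c$ are real constants with $S(X,Y)=a\,g(X,Y)+b\,g(\varphi X,Y)+c\,\eta(X)\eta(Y)$ for all vector fields $X,Y$. $(g,\xi,\lambda,\mu)$ is an $\eta$-Ricci soliton if $\lambda,\mu$ are real constants and $\frac12\mathcal{L}_\xi g+S+\lambda g+\mu\,\eta\otimes\eta=0$. *)

theory Defs
  imports "HOL-Analysis.Analysis" "HOL-Library.Function_Algebras"
begin

section \<open>Functions into a real vector space form a real vector space\<close>

instantiation "fun" :: (type, real_vector) real_vector
begin

definition scaleR_fun :: "real \<Rightarrow> ('a \<Rightarrow> 'b) \<Rightarrow> 'a \<Rightarrow> 'b"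
  where "scaleR_fun c f = (\<lambda>x. c *\<^sub>R f x)"

instance
  by standard (auto simp: scaleR_fun_def fun_eq_iff scaleR_add_right scaleR_add_left)

end

section \<open>Linear algebra on subspaces of a vector space\<close>

definition linear_on :: "'v::real_vector set \<Rightarrow> ('v \<Rightarrow> 'w::real_vector) \<Rightarrow> bool" where
  "linear_on V L \<longleftrightarrow>
     (\<forall>v\<in>V. \<forall>w\<in>V. L (v + w) = L v + L w) \<and> (\<forall>c. \<forall>v\<in>V. L (c *\<^sub>R v) = c *\<^sub>R L v)"

text \<open>Trace of an endomorphism of a finite-dimensional subspace: the sum of the diagonal
  coefficients in a basis (the choice of the basis does not matter).\<close>

definition trace_on :: "'v::real_vector set \<Rightarrow> ('v \<Rightarrow> 'v) \<Rightarrow> real" where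
  "trace_on V L =
     (let B = (SOME B. independent B \<and> span B = V) in \<Sum>b\<in>B. representation B (L b) b)"

definition index_on :: "'v::real_vector set \<Rightarrow> ('v \<Rightarrow> 'v \<Rightarrow> real) \<Rightarrow> nat" where
  "index_on V g =
     (GREATEST q. \<exists>W. subspace W \<and> W \<subseteq> V \<and> dim W = q \<and> (\<forall>w\<in>W. w \<noteq> 0 \<longrightarrow> g w w < 0))"

section \<open>Smooth manifolds\<close>

primrec Ck_on :: "nat \<Rightarrow> 'a::real_normed_vector set \<Rightarrow> ('a \<Rightarrow> 'b::real_normed_vector) \<Rightarrow> bool" where
  "Ck_on 0 S f \<longleftrightarrow> continuous_on S f"
| "Ck_on (Suc k) S f \<longleftrightarrow>
     (\<forall>x\<in>S. f differentiable (at x)) \<and> (\<forall>v. Ck_on k S (\<lambda>x. frechet_derivative f (at x) v))"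

definition smooth_on :: "'a::real_normed_vector set \<Rightarrow> ('a \<Rightarrow> 'b::real_normed_vector) \<Rightarrow> bool" where
  "smooth_on S f \<longleftrightarrow> open S \<and> (\<forall>k. Ck_on k S f)"

text \<open>A chart is a pair \<open>(U, k)\<close> of its domain and its coordinate map. The dimension of the
  manifold is that of the model space \<open>'e\<close>. The atlas need not be maximal.\<close>

record ('m, 'e) mfd =
  Top :: "'m topology"
  Charts :: "('m set \<times> ('m \<Rightarrow> 'e)) set"

abbreviation points :: "('m, 'e) mfd \<Rightarrow> 'm set" where
  "points M \<equiv> topspace (Top M)"

definition smooth_manifold :: "('m, 'e::euclidean_space) mfd \<Rightarrow> bool" where
  "smooth_manifold M \<longleftrightarrow>
     Hausdorff_space (Top M) \<and> second_countable (Top M) \<and>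
     (\<Union>(U, k)\<in>Charts M. U) = points M \<and>
     (\<forall>(U, k)\<in>Charts M. openin (Top M) U \<and> open (k ` U) \<and>
        homeomorphic_map (subtopology (Top M) U) (top_of_set (k ` U)) k) \<and>
     (\<forall>(U, k)\<in>Charts M. \<forall>(V, l)\<in>Charts M. smooth_on (k ` (U \<inter> V)) (l \<circ> inv_into U k))"

text \<open>Functions and fields on \<open>M\<close> are total functions on the type \<open>'m\<close>; their values outside
  \<open>points M\<close> play no role, and identities between them are only required on \<open>points M\<close>.\<close>

definition smooth_functions :: "('m, 'e::euclidean_space) mfd \<Rightarrow> ('m \<Rightarrow> real) set" where
  "smooth_functions M = {f. \<forall>(U, k)\<in>Charts M. smooth_on (k ` U) (f \<circ> inv_into U k)}"

text \<open>Tangent vectors at \<open>p\<close> are derivations at \<open>p\<close> of the algebra of smooth functions. They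
  vanish on non-smooth functions by convention, so that a derivation is a unique HOL function.\<close>

type_synonym 'm tvec = "('m \<Rightarrow> real) \<Rightarrow> real"

definition tangent_space :: "('m, 'e::euclidean_space) mfd \<Rightarrow> 'm \<Rightarrow> 'm tvec set" where
  "tangent_space M p = {v.
     linear_on (smooth_functions M) v \<and>
     (\<forall>f\<in>smooth_functions M. \<forall>h\<in>smooth_functions M. v (f * h) = v f * h p + f p * v h) \<and>
     (\<forall>f. f \<notin> smooth_functions M \<longrightarrow> v f = 0)}"

type_synonym 'm vfield = "'m \<Rightarrow> 'm tvec"

definition vector_fields :: "('m, 'e::euclidean_space) mfd \<Rightarrow> 'm vfield set" where
  "vector_fields M = {X.
     (\<forall>p\<in>points M. X p \<in> tangent_space M p) \<and>
     (\<forall>f\<in>smooth_functions M. (\<lambda>p. X p f) \<in> smooth_functions M)}"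

definition bracket :: "'m vfield \<Rightarrow> 'm vfield \<Rightarrow> 'm vfield" where
  "bracket X Y = (\<lambda>p f. X p (\<lambda>q. Y q f) - Y p (\<lambda>q. X q f))"

section \<open>Tensor fields\<close>

definition one_form :: "('m, 'e::euclidean_space) mfd \<Rightarrow> ('m \<Rightarrow> 'm tvec \<Rightarrow> real) \<Rightarrow> bool" where
  "one_form M \<eta> \<longleftrightarrow>
     (\<forall>p\<in>points M. linear_on (tangent_space M p) (\<eta> p)) \<and>
     (\<forall>X\<in>vector_fields M. (\<lambda>p. \<eta> p (X p)) \<in> smooth_functions M)"

definition tensor_field_1_1 ::
    "('m, 'e::euclidean_space) mfd \<Rightarrow> ('m \<Rightarrow> 'm tvec \<Rightarrow> 'm tvec) \<Rightarrow> bool" where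
  "tensor_field_1_1 M \<phi> \<longleftrightarrow>
     (\<forall>p\<in>points M. linear_on (tangent_space M p) (\<phi> p) \<and>
        \<phi> p ` tangent_space M p \<subseteq> tangent_space M p) \<and>
     (\<forall>X\<in>vector_fields M. (\<lambda>p. \<phi> p (X p)) \<in> vector_fields M)"

definition tensor_field_0_2 ::
    "('m, 'e::euclidean_space) mfd \<Rightarrow> ('m \<Rightarrow> 'm tvec \<Rightarrow> 'm tvec \<Rightarrow> real) \<Rightarrow> bool" where
  "tensor_field_0_2 M g \<longleftrightarrow>
     (\<forall>p\<in>points M. \<forall>v\<in>tangent_space M p.
        linear_on (tangent_space M p) (\<lambda>w. g p v w) \<and>
        linear_on (tangent_space M p) (\<lambda>w. g p w v)) \<and>
     (\<forall>X\<in>vector_fields M. \<forall>Y\<in>vector_fields M. (\<lambda>p. g p (X p) (Y p)) \<in> smooth_functions M)"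

definition pseudo_riemannian_metric ::
    "('m, 'e::euclidean_space) mfd \<Rightarrow> ('m \<Rightarrow> 'm tvec \<Rightarrow> 'm tvec \<Rightarrow> real) \<Rightarrow> bool" where
  "pseudo_riemannian_metric M g \<longleftrightarrow>
     tensor_field_0_2 M g \<and>
     (\<forall>p\<in>points M. \<forall>v\<in>tangent_space M p. \<forall>w\<in>tangent_space M p. g p v w = g p w v) \<and>
     (\<forall>p\<in>points M. \<forall>v\<in>tangent_space M p. (\<forall>w\<in>tangent_space M p. g p v w = 0) \<longrightarrow> v = 0) \<and>
     (\<exists>q. \<forall>p\<in>points M. index_on (tangent_space M p) (g p) = q)"

text \<open>\<open>\<L>\<^sub>Z g\<close>, as a bilinear map on vector fields.\<close>

definition lie_derivative ::
    "'m vfield \<Rightarrow> ('m \<Rightarrow> 'm tvec \<Rightarrow> 'm tvec \<Rightarrow> real) \<Rightarrow> 'm vfield \<Rightarrow> 'm vfield \<Rightarrow> 'm \<Rightarrow> real" where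
  "lie_derivative Z g X Y = (\<lambda>p.
     Z p (\<lambda>q. g q (X q) (Y q)) - g p (bracket Z X p) (Y p) - g p (X p) (bracket Z Y p))"

section \<open>Connections and curvature\<close>

type_synonym 'm connection = "'m vfield \<Rightarrow> 'm vfield \<Rightarrow> 'm vfield"

definition affine_connection :: "('m, 'e::euclidean_space) mfd \<Rightarrow> 'm connection \<Rightarrow> bool" where
  "affine_connection M D \<longleftrightarrow>
     (\<forall>X\<in>vector_fields M. \<forall>Y\<in>vector_fields M. D X Y \<in> vector_fields M) \<and>
     (\<forall>X\<in>vector_fields M. \<forall>X'\<in>vector_fields M. \<forall>Y\<in>vector_fields M. \<forall>p\<in>points M.
        D (X + X') Y p = D X Y p + D X' Y p \<and>
        D Y (X + X') p = D Y X p + D Y X' p) \<and>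
     (\<forall>f\<in>smooth_functions M. \<forall>X\<in>vector_fields M. \<forall>Y\<in>vector_fields M. \<forall>p\<in>points M.
        D (\<lambda>q. f q *\<^sub>R X q) Y p = f p *\<^sub>R D X Y p \<and>
        D X (\<lambda>q. f q *\<^sub>R Y q) p = X p f *\<^sub>R Y p + f p *\<^sub>R D X Y p)"

definition levi_civita ::
    "('m, 'e::euclidean_space) mfd \<Rightarrow> ('m \<Rightarrow> 'm tvec \<Rightarrow> 'm tvec \<Rightarrow> real) \<Rightarrow> 'm connection \<Rightarrow> bool" where
  "levi_civita M g D \<longleftrightarrow>
     affine_connection M D \<and>
     (\<forall>X\<in>vector_fields M. \<forall>Y\<in>vector_fields M. \<forall>p\<in>points M.
        D X Y p - D Y X p = bracket X Y p) \<and>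
     (\<forall>X\<in>vector_fields M. \<forall>Y\<in>vector_fields M. \<forall>Z\<in>vector_fields M. \<forall>p\<in>points M.
        X p (\<lambda>q. g q (Y q) (Z q)) = g p (D X Y p) (Z p) + g p (Y p) (D X Z p))"

text \<open>\<open>(\<nabla>\<^sub>X \<phi>) Y\<close>\<close>

definition cov_deriv_1_1 ::
    "'m connection \<Rightarrow> ('m \<Rightarrow> 'm tvec \<Rightarrow> 'm tvec) \<Rightarrow> 'm vfield \<Rightarrow> 'm vfield \<Rightarrow> 'm vfield" where
  "cov_deriv_1_1 D \<phi> X Y = (\<lambda>p. D X (\<lambda>q. \<phi> q (Y q)) p - \<phi> p (D X Y p))"

text \<open>\<open>(\<nabla>\<^sub>X \<alpha>) (Y, Z)\<close>, for \<open>\<alpha>\<close> given as a bilinear map on vector fields.\<close>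

definition cov_deriv_0_2 ::
    "'m connection \<Rightarrow> ('m vfield \<Rightarrow> 'm vfield \<Rightarrow> 'm \<Rightarrow> real) \<Rightarrow>
     'm vfield \<Rightarrow> 'm vfield \<Rightarrow> 'm vfield \<Rightarrow> 'm \<Rightarrow> real" where
  "cov_deriv_0_2 D \<alpha> X Y Z = (\<lambda>p. X p (\<alpha> Y Z) - \<alpha> (D X Y) Z p - \<alpha> Y (D X Z) p)"

definition parallel ::
    "('m, 'e::euclidean_space) mfd \<Rightarrow> 'm connection \<Rightarrow>
     ('m vfield \<Rightarrow> 'm vfield \<Rightarrow> 'm \<Rightarrow> real) \<Rightarrow> bool" where
  "parallel M D \<alpha> \<longleftrightarrow>
     (\<forall>X\<in>vector_fields M. \<forall>Y\<in>vector_fields M. \<forall>Z\<in>vector_fields M. \<forall>p\<in>points M.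
        cov_deriv_0_2 D \<alpha> X Y Z p = 0)"

definition curvature ::
    "'m connection \<Rightarrow> 'm vfield \<Rightarrow> 'm vfield \<Rightarrow> 'm vfield \<Rightarrow> 'm vfield" where
  "curvature D X Y Z = D X (D Y Z) - D Y (D X Z) - D (bracket X Y) Z"

text \<open>The curvature at \<open>p\<close> depends on \<open>X\<close> only through \<open>X p\<close>. So the endomorphism of the tangent
  space at \<open>p\<close> whose trace is the Ricci tensor sends \<open>v\<close> to the value at \<open>p\<close> of
  \<open>curvature D X Y Z\<close>, where \<open>X\<close> is any vector field through \<open>v\<close>.\<close>

definition extension :: "('m, 'e::euclidean_space) mfd \<Rightarrow> 'm \<Rightarrow> 'm tvec \<Rightarrow> 'm vfield" where
  "extension M p v = (SOME X. X \<in> vector_fields M \<and> X p = v)"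

definition ricci ::
    "('m, 'e::euclidean_space) mfd \<Rightarrow> 'm connection \<Rightarrow> 'm vfield \<Rightarrow> 'm vfield \<Rightarrow> 'm \<Rightarrow> real" where
  "ricci M D Y Z = (\<lambda>p. trace_on (tangent_space M p) (\<lambda>v. curvature D (extension M p v) Y Z p))"

section \<open>Almost paracontact metric structures\<close>

definition eps_almost_paracontact_metric ::
    "('m, 'e::euclidean_space) mfd \<Rightarrow> ('m \<Rightarrow> 'm tvec \<Rightarrow> 'm tvec) \<Rightarrow> 'm vfield \<Rightarrow>
     ('m \<Rightarrow> 'm tvec \<Rightarrow> real) \<Rightarrow> ('m \<Rightarrow> 'm tvec \<Rightarrow> 'm tvec \<Rightarrow> real) \<Rightarrow> real \<Rightarrow> bool" where
  "eps_almost_paracontact_metric M \<phi> \<xi> \<eta> g \<epsilon> \<longleftrightarrow>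
     tensor_field_1_1 M \<phi> \<and> \<xi> \<in> vector_fields M \<and> one_form M \<eta> \<and>
     pseudo_riemannian_metric M g \<and> \<epsilon> \<in> {1, -1} \<and>
     (\<forall>p\<in>points M. \<forall>v\<in>tangent_space M p. \<phi> p (\<phi> p v) = v - \<eta> p v *\<^sub>R \<xi> p) \<and>
     (\<forall>p\<in>points M. \<eta> p (\<xi> p) = 1) \<and>
     (\<forall>p\<in>points M. \<phi> p (\<xi> p) = 0) \<and>
     (\<forall>p\<in>points M. \<forall>v\<in>tangent_space M p. \<eta> p (\<phi> p v) = 0) \<and>
     (\<forall>X\<in>vector_fields M. \<forall>Y\<in>vector_fields M. \<forall>p\<in>points M.
        g p (\<phi> p (X p)) (\<phi> p (Y p)) = g p (X p) (Y p) - \<epsilon> * \<eta> p (X p) * \<eta> p (Y p))"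

definition eps_para_sasakian ::
    "('m, 'e::euclidean_space) mfd \<Rightarrow> ('m \<Rightarrow> 'm tvec \<Rightarrow> 'm tvec) \<Rightarrow> 'm vfield \<Rightarrow>
     ('m \<Rightarrow> 'm tvec \<Rightarrow> real) \<Rightarrow> ('m \<Rightarrow> 'm tvec \<Rightarrow> 'm tvec \<Rightarrow> real) \<Rightarrow> real \<Rightarrow>
     'm connection \<Rightarrow> bool" where
  "eps_para_sasakian M \<phi> \<xi> \<eta> g \<epsilon> D \<longleftrightarrow>
     eps_almost_paracontact_metric M \<phi> \<xi> \<eta> g \<epsilon> \<and> levi_civita M g D \<and>
     (\<forall>X\<in>vector_fields M. \<forall>Y\<in>vector_fields M. \<forall>p\<in>points M.
        cov_deriv_1_1 D \<phi> X Y p =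
          - (g p (\<phi> p (X p)) (\<phi> p (Y p)) *\<^sub>R \<xi> p) - (\<epsilon> * \<eta> p (Y p)) *\<^sub>R \<phi> p (\<phi> p (X p)))"

definition einstein_like ::
    "('m, 'e::euclidean_space) mfd \<Rightarrow> ('m \<Rightarrow> 'm tvec \<Rightarrow> 'm tvec) \<Rightarrow>
     ('m \<Rightarrow> 'm tvec \<Rightarrow> real) \<Rightarrow> ('m \<Rightarrow> 'm tvec \<Rightarrow> 'm tvec \<Rightarrow> real) \<Rightarrow>
     'm connection \<Rightarrow> real \<Rightarrow> real \<Rightarrow> real \<Rightarrow> bool" where
  "einstein_like M \<phi> \<eta> g D a b c \<longleftrightarrow>
     (\<forall>X\<in>vector_fields M. \<forall>Y\<in>vector_fields M. \<forall>p\<in>points M.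
        ricci M D X Y p =
          a * g p (X p) (Y p) + b * g p (\<phi> p (X p)) (Y p) + c * \<eta> p (X p) * \<eta> p (Y p))"

definition eta_ricci_soliton ::
    "('m, 'e::euclidean_space) mfd \<Rightarrow> ('m \<Rightarrow> 'm tvec \<Rightarrow> real) \<Rightarrow> 'm connection \<Rightarrow>
     ('m \<Rightarrow> 'm tvec \<Rightarrow> 'm tvec \<Rightarrow> real) \<Rightarrow> 'm vfield \<Rightarrow> real \<Rightarrow> real \<Rightarrow> bool" where
  "eta_ricci_soliton M \<eta> D g \<xi> lam \<mu> \<longleftrightarrow>
     (\<forall>X\<in>vector_fields M. \<forall>Y\<in>vector_fields M. \<forall>p\<in>points M.
        1/2 * lie_derivative \<xi> g X Y p + ricci M D X Y p + lam * g p (X p) (Y p)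
          + \<mu> * \<eta> p (X p) * \<eta> p (Y p) = 0)"

end

theory Submission
  imports Defs
begin

text \<open>
  Write \<open>A = \<epsilon> + b\<close>, \<open>C = \<epsilon> (c + \<mu>)\<close> and
  \<open>F(X,Y) = A g(\<phi>X,Y) - C g(\<phi>X,\<phi>Y)\<close>. The structure equation forces \<open>\<nabla>\<^sub>X \<xi> = \<epsilon> \<phi>X\<close>, hence
  \<open>\<L>\<^sub>\<xi> g = 2\<epsilon> g(\<phi>\<cdot>,\<cdot>)\<close>. Together with the Einstein-like condition and
  \<open>\<eta> \<otimes> \<eta> = \<epsilon> (g - g(\<phi>\<cdot>,\<phi>\<cdot>))\<close> this gives \<open>\<alpha> = F + (a + C) g\<close>. So \<open>F\<close> is exactly the tensor
  whose vanishing is the soliton equation for \<open>\<lambda> = -(a + C)\<close>, and \<open>\<nabla>\<alpha> = \<nabla>F\<close> because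
  \<open>\<nabla>g = 0\<close>. The formula for \<open>\<nabla>\<phi>\<close> turns this derivative back into \<open>F\<close>:
  \<open>(\<nabla>\<^sub>X \<alpha>)(Y,Z) = - \<epsilon> (\<eta>(Z) F(X,\<phi>Y) + \<eta>(Y) F(X,\<phi>Z))\<close>.
  If \<open>F = 0\<close>, the right-hand side vanishes. Conversely, if it vanishes, \<open>Z = \<xi>\<close> yields
  \<open>F(X,\<phi>Y) = 0\<close>, and replacing \<open>Y\<close> by \<open>\<phi>Y\<close> yields \<open>F(X,Y) = F(X,\<phi>\<^sup>2Y) = 0\<close>, since
  \<open>F(X,\<xi>) = 0\<close>.

  The tensor identities above hold only at points of the manifold, whereas vector fields and
  functions are total on the underlying type. The computation therefore rests on two analytic
  facts: tangent vectors and connections ignore values outside the manifold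
  (\<open>tangent_vector_cong\<close>, \<open>affine_connection_zero_on_points\<close>), and the smooth functions form a
  vector space, so that a tangent vector can be applied to a sum term by term. The geometric
  content is in \<open>D_xi\<close> and \<open>cov_deriv_defect_plus_metric\<close>.
\<close>

section \<open>Smooth functions and tangent vectors\<close>

text \<open>Derivatives are local, so on an open set only the values there matter. This is also what
  carries the inductions for sums and multiples: the derivative of a sum is the sum of the
  derivatives only where both summands are differentiable, that is, on \<open>S\<close>.\<close>

lemma Ck_on_cong:
  assumes "open S" and "\<And>x. x \<in> S \<Longrightarrow> f x = h x" and "Ck_on k S f"
  shows "Ck_on k S h"
  using assms(2,3)
proof (induction k arbitrary: f h)
  case 0
  then show ?case
    using continuous_on_cong[of S S f h] by simp
next
  case (Suc k)
  have diff: "f differentiable (at x)" if "x \<in> S" for x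
    using Suc.prems(2) that by simp
  have fd: "frechet_derivative f (at x) = frechet_derivative h (at x)" if "x \<in> S" for x
    using frechet_derivative_transform_within_open[OF diff[OF that] assms(1) that] Suc.prems(1)
    by blast
  have "h differentiable (at x)" if "x \<in> S" for x
    using diff[OF that] has_derivative_transform_within_open[OF _ assms(1) that] Suc.prems(1)
    unfolding differentiable_def by metis
  moreover have "Ck_on k S (\<lambda>x. frechet_derivative h (at x) v)" for v
  proof (rule Suc.IH)
    show "Ck_on k S (\<lambda>x. frechet_derivative f (at x) v)"
      using Suc.prems(2) by simp
  qed (simp add: fd)
  ultimately show ?case by simp
qed

lemma Ck_on_const: "Ck_on k S (\<lambda>x. c)"
  by (induction k arbitrary: c) (simp_all add: frechet_derivative_const)

lemma Ck_on_add:
  assumes "open S" and "Ck_on k S f" and "Ck_on k S h"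
  shows "Ck_on k S (\<lambda>x. f x + h x)"
  using assms(2,3)
proof (induction k arbitrary: f h)
  case 0
  then show ?case by (simp add: continuous_on_add)
next
  case (Suc k)
  have der: "((\<lambda>x. f x + h x) has_derivative
      (\<lambda>v. frechet_derivative f (at x) v + frechet_derivative h (at x) v)) (at x)"
    if "x \<in> S" for x
    using Suc.prems that by (intro has_derivative_add) (simp_all add: frechet_derivative_works)
  have "Ck_on k S (\<lambda>x. frechet_derivative (\<lambda>x. f x + h x) (at x) v)" for v
  proof (rule Ck_on_cong[OF assms(1)])
    show "Ck_on k S (\<lambda>x. frechet_derivative f (at x) v + frechet_derivative h (at x) v)"
      using Suc by simp
    show "frechet_derivative f (at x) v + frechet_derivative h (at x) v
          = frechet_derivative (\<lambda>x. f x + h x) (at x) v" if "x \<in> S" for x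
      using frechet_derivative_at[OF der[OF that]] by metis
  qed
  then show ?case
    using der by (auto simp: differentiable_def)
qed

lemma Ck_on_scaleR:
  assumes "open S" and "Ck_on k S f"
  shows "Ck_on k S (\<lambda>x. c *\<^sub>R f x)"
  using assms(2)
proof (induction k arbitrary: f)
  case 0
  then show ?case by (simp add: continuous_on_scaleR)
next
  case (Suc k)
  have der: "((\<lambda>x. c *\<^sub>R f x) has_derivative (\<lambda>v. c *\<^sub>R frechet_derivative f (at x) v)) (at x)"
    if "x \<in> S" for x
    using Suc.prems that by (intro has_derivative_scaleR_right) (simp add: frechet_derivative_works)
  have "Ck_on k S (\<lambda>x. frechet_derivative (\<lambda>x. c *\<^sub>R f x) (at x) v)" for v
  proof (rule Ck_on_cong[OF assms(1)])
    show "Ck_on k S (\<lambda>x. c *\<^sub>R frechet_derivative f (at x) v)"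
      using Suc by simp
    show "c *\<^sub>R frechet_derivative f (at x) v = frechet_derivative (\<lambda>x. c *\<^sub>R f x) (at x) v"
      if "x \<in> S" for x
      using frechet_derivative_at[OF der[OF that]] by metis
  qed
  then show ?case
    using der by (auto simp: differentiable_def)
qed

lemma
  assumes "smooth_manifold M" and "(U, k) \<in> Charts M"
  shows open_chart_image: "open (k ` U)"
    and chart_domain_subset: "U \<subseteq> points M"
  using assms openin_subset unfolding smooth_manifold_def by fastforce+

lemma smooth_functions_cong:
  assumes "smooth_manifold M" and "f \<in> smooth_functions M"
    and "\<And>p. p \<in> points M \<Longrightarrow> f p = h p"
  shows "h \<in> smooth_functions M"
  unfolding smooth_functions_def smooth_on_def
proof (clarify, intro conjI allI)
  fix U k n
  assume chart: "(U, k) \<in> Charts M"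
  show "open (k ` U)"
    using open_chart_image[OF assms(1) chart] .
  show "Ck_on n (k ` U) (h \<circ> inv_into U k)"
  proof (rule Ck_on_cong[OF open_chart_image[OF assms(1) chart]])
    show "Ck_on n (k ` U) (f \<circ> inv_into U k)"
      using assms(2) chart unfolding smooth_functions_def smooth_on_def by blast
    show "(f \<circ> inv_into U k) x = (h \<circ> inv_into U k) x" if "x \<in> k ` U" for x
      using that inv_into_into[OF that] chart_domain_subset[OF assms(1) chart] assms(3) by auto
  qed
qed

lemma smooth_functions_const:
  assumes "smooth_manifold M"
  shows "(\<lambda>p. c) \<in> smooth_functions M"
  using open_chart_image[OF assms] Ck_on_const[of _ _ c]
  unfolding smooth_functions_def smooth_on_def comp_def by blast

lemma smooth_functions_add:
  assumes "f \<in> smooth_functions M" and "h \<in> smooth_functions M"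
  shows "(\<lambda>p. f p + h p) \<in> smooth_functions M"
  using assms Ck_on_add unfolding smooth_functions_def smooth_on_def comp_def by blast

lemma smooth_functions_mult_const:
  assumes "f \<in> smooth_functions M"
  shows "(\<lambda>p. c * f p) \<in> smooth_functions M"
  using assms Ck_on_scaleR[where 'b = real]
  unfolding smooth_functions_def smooth_on_def comp_def real_scaleR_def by blast

lemma smooth_functions_indicator_points:
  assumes "smooth_manifold M"
  shows "(\<lambda>p. if p \<in> points M then x else y) \<in> smooth_functions M"
  by (rule smooth_functions_cong[OF assms smooth_functions_const[OF assms, of x]]) simp

lemma tangent_vector_add:
  assumes "v \<in> tangent_space M p" "f \<in> smooth_functions M" "h \<in> smooth_functions M"
  shows "v (\<lambda>q. f q + h q) = v f + v h"
  using assms unfolding tangent_space_def linear_on_def plus_fun_def by blast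

lemma tangent_vector_mult_const:
  assumes "v \<in> tangent_space M p" "f \<in> smooth_functions M"
  shows "v (\<lambda>q. c * f q) = c * v f"
  using assms unfolding tangent_space_def linear_on_def scaleR_fun_def real_scaleR_def by blast

lemma tangent_vector_mult:
  assumes "v \<in> tangent_space M p" "f \<in> smooth_functions M" "h \<in> smooth_functions M"
  shows "v (\<lambda>q. f q * h q) = v f * h p + f p * v h"
  using assms unfolding tangent_space_def times_fun_def by blast

text \<open>The indicator \<open>u\<close> of the manifold satisfies \<open>u u = u\<close>, so \<open>v u = 2 v u = 0\<close>, and the Leibniz
  rule gives \<open>v f = v (u f)\<close>, where \<open>u f\<close> has forgotten the values of \<open>f\<close> off the manifold.\<close>

lemma tangent_vector_cong:
  assumes M: "smooth_manifold M" and v: "v \<in> tangent_space M p" and p: "p \<in> points M"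
    and eq: "\<And>q. q \<in> points M \<Longrightarrow> f q = h q"
  shows "v f = v h"
proof (cases "f \<in> smooth_functions M")
  case True
  then have h: "h \<in> smooth_functions M"
    using smooth_functions_cong[OF M] eq by blast
  define u :: "'a \<Rightarrow> real" where "u = (\<lambda>q. if q \<in> points M then 1 else 0)"
  have u: "u \<in> smooth_functions M"
    unfolding u_def by (rule smooth_functions_indicator_points[OF M])
  have "(\<lambda>q. u q * u q) = u"
    by (auto simp: u_def)
  then have "v u = 0"
    using tangent_vector_mult[OF v u u] p by (simp add: u_def)
  then have "v (\<lambda>q. u q * f q) = v f" "v (\<lambda>q. u q * h q) = v h"
    using tangent_vector_mult[OF v u] True h p by (simp_all add: u_def)
  moreover have "(\<lambda>q. u q * f q) = (\<lambda>q. u q * h q)"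
    using eq by (auto simp: u_def)
  ultimately show ?thesis by simp
next
  case False
  then have "h \<notin> smooth_functions M"
    using smooth_functions_cong[OF M, of h f] eq by metis
  with False show ?thesis
    using v unfolding tangent_space_def by simp
qed

lemma tangent_vector_const:
  assumes M: "smooth_manifold M" and v: "v \<in> tangent_space M p"
  shows "v (\<lambda>q. c) = 0"
proof -
  note one = smooth_functions_const[OF M, of 1]
  have "v (\<lambda>q. 1) = 0"
    using tangent_vector_mult[OF v one one] by simp
  then show ?thesis
    using tangent_vector_mult_const[OF v one, of c] by simp
qed

lemma subspace_tangent_space: "subspace (tangent_space M p)"
  unfolding subspace_def tangent_space_def linear_on_def
  by (auto simp: scaleR_fun_def algebra_simps)

lemma vector_fields_at: "X \<in> vector_fields M \<Longrightarrow> p \<in> points M \<Longrightarrow> X p \<in> tangent_space M p"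
  unfolding vector_fields_def by blast

text \<open>A field that vanishes on the manifold is unchanged by multiplication with the indicator of
  the complement, which is a smooth function vanishing on the manifold.\<close>

lemma affine_connection_zero_on_points:
  assumes M: "smooth_manifold M" and D: "affine_connection M D"
    and X: "X \<in> vector_fields M" and Y: "Y \<in> vector_fields M" and p: "p \<in> points M"
    and zero: "\<And>q. q \<in> points M \<Longrightarrow> Y q = 0"
  shows "D X Y p = 0"
proof -
  define u :: "'a \<Rightarrow> real" where "u = (\<lambda>q. if q \<in> points M then 0 else 1)"
  have u: "u \<in> smooth_functions M"
    unfolding u_def by (rule smooth_functions_indicator_points[OF M])
  have "(\<lambda>q. u q *\<^sub>R Y q) = Y"
    using zero by (auto simp: u_def)
  moreover have "D X (\<lambda>q. u q *\<^sub>R Y q) p = X p u *\<^sub>R Y p + u p *\<^sub>R D X Y p"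
    using D u X Y p unfolding affine_connection_def by blast
  ultimately show ?thesis
    using zero[OF p] p by (simp add: u_def)
qed

section \<open>Para Sasakian geometry\<close>

locale eps_para_sasakian_manifold =
  fixes M :: "('m, 'e::euclidean_space) mfd"
    and \<phi> :: "'m \<Rightarrow> 'm tvec \<Rightarrow> 'm tvec" and \<xi> :: "'m vfield" and \<eta> :: "'m \<Rightarrow> 'm tvec \<Rightarrow> real"
    and g :: "'m \<Rightarrow> 'm tvec \<Rightarrow> 'm tvec \<Rightarrow> real" and D :: "'m connection"
    and \<epsilon> :: real
  assumes manifold: "smooth_manifold M"
    and para_sasakian: "eps_para_sasakian M \<phi> \<xi> \<eta> g \<epsilon> D"
begin

lemma paracontact: "eps_almost_paracontact_metric M \<phi> \<xi> \<eta> g \<epsilon>"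
  and levi_civita: "levi_civita M g D"
  using para_sasakian unfolding eps_para_sasakian_def by blast+

lemma metric: "pseudo_riemannian_metric M g"
  using paracontact unfolding eps_almost_paracontact_metric_def by (elim conjE)

lemma tensor_g: "tensor_field_0_2 M g"
  using metric unfolding pseudo_riemannian_metric_def by (elim conjE)

lemma g_sym:
  "\<lbrakk>p \<in> points M; v \<in> tangent_space M p; w \<in> tangent_space M p\<rbrakk> \<Longrightarrow> g p v w = g p w v"
  using metric unfolding pseudo_riemannian_metric_def by (elim conjE) simp

lemma tensor_phi: "tensor_field_1_1 M \<phi>"
  using paracontact unfolding eps_almost_paracontact_metric_def by (elim conjE)

lemma xi: "\<xi> \<in> vector_fields M"
  using paracontact unfolding eps_almost_paracontact_metric_def by (elim conjE)

lemma eps_cases: "\<epsilon> \<in> {1, -1}"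
  using paracontact unfolding eps_almost_paracontact_metric_def by (elim conjE)

lemma eps_square [simp]: "\<epsilon> * \<epsilon> = 1" "\<epsilon> * (\<epsilon> * x) = x"
  using eps_cases by auto

lemma phi_field: "X \<in> vector_fields M \<Longrightarrow> (\<lambda>q. \<phi> q (X q)) \<in> vector_fields M"
  using tensor_phi unfolding tensor_field_1_1_def by (elim conjE) simp

lemma D_field: "\<lbrakk>X \<in> vector_fields M; Y \<in> vector_fields M\<rbrakk> \<Longrightarrow> D X Y \<in> vector_fields M"
  using levi_civita unfolding levi_civita_def affine_connection_def by (elim conjE) simp

lemma g_smooth: "\<lbrakk>X \<in> vector_fields M; Y \<in> vector_fields M\<rbrakk> \<Longrightarrow> (\<lambda>q. g q (X q) (Y q)) \<in> smooth_functions M"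
  using tensor_g unfolding tensor_field_0_2_def by (elim conjE) simp

lemma D_torsion_free:
  "\<lbrakk>X \<in> vector_fields M; Y \<in> vector_fields M; p \<in> points M\<rbrakk> \<Longrightarrow> bracket X Y p = D X Y p - D Y X p"
  using levi_civita unfolding levi_civita_def by (elim conjE) simp

lemma D_metric:
  assumes "X \<in> vector_fields M" "Y \<in> vector_fields M" "Z \<in> vector_fields M" "p \<in> points M"
  shows "X p (\<lambda>q. g q (Y q) (Z q)) = g p (D X Y p) (Z p) + g p (Y p) (D X Z p)"
proof -
  have "\<forall>X\<in>vector_fields M. \<forall>Y\<in>vector_fields M. \<forall>Z\<in>vector_fields M. \<forall>p\<in>points M.
      X p (\<lambda>q. g q (Y q) (Z q)) = g p (D X Y p) (Z p) + g p (Y p) (D X Z p)"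
    using levi_civita unfolding levi_civita_def by (elim conjE)
  then show ?thesis
    using assms by blast
qed

context
  fixes p
  assumes p: "p \<in> points M"
begin

lemma phi_tangent: "v \<in> tangent_space M p \<Longrightarrow> \<phi> p v \<in> tangent_space M p"
  using tensor_phi p unfolding tensor_field_1_1_def by (elim conjE) (simp add: image_subset_iff)

lemma tangent_closed:
  assumes "v \<in> tangent_space M p"
  shows "c *\<^sub>R v \<in> tangent_space M p" "w \<in> tangent_space M p \<Longrightarrow> v - w \<in> tangent_space M p"
  using subspace_tangent_space[of M p] assms
  by (blast intro: subspace_scale subspace_diff)+

lemma phi_scale: "v \<in> tangent_space M p \<Longrightarrow> \<phi> p (c *\<^sub>R v) = c *\<^sub>R \<phi> p v"
  using tensor_phi p unfolding tensor_field_1_1_def linear_on_def by (elim conjE) simp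

lemma g_add_left:
  "\<lbrakk>u \<in> tangent_space M p; v \<in> tangent_space M p; w \<in> tangent_space M p\<rbrakk>
    \<Longrightarrow> g p (u + v) w = g p u w + g p v w"
  and g_scale_left:
  "\<lbrakk>u \<in> tangent_space M p; w \<in> tangent_space M p\<rbrakk> \<Longrightarrow> g p (c *\<^sub>R u) w = c * g p u w"
  using tensor_g p unfolding tensor_field_0_2_def linear_on_def by auto

lemma g_diff_left:
  assumes "u \<in> tangent_space M p" "v \<in> tangent_space M p" "w \<in> tangent_space M p"
  shows "g p (u - v) w = g p u w - g p v w"
  using g_add_left[OF tangent_closed(2)[OF assms(1,2)] assms(2,3)] by simp

lemma g_diff_right:
  assumes "u \<in> tangent_space M p" "v \<in> tangent_space M p" "w \<in> tangent_space M p"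
  shows "g p w (u - v) = g p w u - g p w v"
  using g_diff_left[OF assms] assms by (simp add: g_sym[OF p] tangent_closed)

lemma xi_tangent: "\<xi> p \<in> tangent_space M p"
  by (rule vector_fields_at[OF xi p])

lemma eta_xi: "\<eta> p (\<xi> p) = 1"
  using paracontact p unfolding eps_almost_paracontact_metric_def by (elim conjE) simp

lemma phi_xi: "\<phi> p (\<xi> p) = 0"
  using paracontact p unfolding eps_almost_paracontact_metric_def by (elim conjE) simp

lemma phi_phi: "v \<in> tangent_space M p \<Longrightarrow> \<phi> p (\<phi> p v) = v - \<eta> p v *\<^sub>R \<xi> p"
  using paracontact p unfolding eps_almost_paracontact_metric_def
  by (elim conjE) simp

lemma eta_phi: "v \<in> tangent_space M p \<Longrightarrow> \<eta> p (\<phi> p v) = 0"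
  using paracontact p unfolding eps_almost_paracontact_metric_def
  by (elim conjE) simp

lemma phi_phi_phi: "v \<in> tangent_space M p \<Longrightarrow> \<phi> p (\<phi> p (\<phi> p v)) = \<phi> p v"
  using phi_phi[OF phi_tangent] eta_phi by simp

lemma g_phi_phi:
  "\<lbrakk>X \<in> vector_fields M; Y \<in> vector_fields M\<rbrakk> \<Longrightarrow>
    g p (\<phi> p (X p)) (\<phi> p (Y p)) = g p (X p) (Y p) - \<epsilon> * \<eta> p (X p) * \<eta> p (Y p)"
  using paracontact p unfolding eps_almost_paracontact_metric_def by (elim conjE) simp

text \<open>The compatibility of \<open>g\<close> and \<open>\<phi>\<close>, evaluated at \<open>\<xi>\<close>, where \<open>\<phi>\<xi> = 0\<close>.\<close>

lemma g_xi:
  assumes "X \<in> vector_fields M"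
  shows "g p (X p) (\<xi> p) = \<epsilon> * \<eta> p (X p)"
proof -
  have "0 \<in> tangent_space M p"
    using subspace_0[OF subspace_tangent_space] .
  then have "g p (\<phi> p (X p)) 0 = 0"
    using g_diff_right[of 0 0 "\<phi> p (X p)"] phi_tangent vector_fields_at[OF assms p] by simp
  then show ?thesis
    using g_phi_phi[OF assms xi] by (simp add: phi_xi eta_xi)
qed

text \<open>The compatibility condition gives \<open>g(X,\<phi>Y) = g(\<phi>X,\<phi>\<^sup>2Y)\<close>, and \<open>\<phi>\<^sup>2Y\<close> differs from \<open>Y\<close> by a
  multiple of \<open>\<xi>\<close>, which is orthogonal to \<open>\<phi>X\<close>.\<close>

lemma g_phi_swap:
  assumes X: "X \<in> vector_fields M" and Y: "Y \<in> vector_fields M"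
  shows "g p (X p) (\<phi> p (Y p)) = g p (\<phi> p (X p)) (Y p)"
proof -
  note Xp = vector_fields_at[OF X p] and Yp = vector_fields_at[OF Y p]
  have "g p (X p) (\<phi> p (Y p)) = g p (\<phi> p (X p)) (\<phi> p (\<phi> p (Y p)))"
    using g_phi_phi[OF X phi_field[OF Y]] eta_phi[OF Yp] by simp
  also have "\<dots> = g p (\<phi> p (X p)) (Y p) - g p (\<eta> p (Y p) *\<^sub>R \<xi> p) (\<phi> p (X p))"
    using Xp Yp
    by (simp add: phi_phi g_diff_right tangent_closed phi_tangent xi_tangent g_sym[OF p, of "_ *\<^sub>R _"])
  also have "g p (\<eta> p (Y p) *\<^sub>R \<xi> p) (\<phi> p (X p)) = 0"
    using g_xi[OF phi_field[OF X]] eta_phi[OF Xp] g_sym[OF p xi_tangent phi_tangent[OF Xp]]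
    by (simp add: g_scale_left phi_tangent Xp xi_tangent)
  finally show ?thesis by simp
qed

lemma g_phi_phi_phi:
  assumes X: "X \<in> vector_fields M" and Y: "Y \<in> vector_fields M"
  shows "g p (\<phi> p (X p)) (\<phi> p (\<phi> p (Y p))) = g p (\<phi> p (X p)) (Y p)"
  using g_phi_swap[OF phi_field[OF X] phi_field[OF Y]]
    g_phi_swap[OF phi_field[OF phi_field[OF X]] Y]
    phi_phi_phi[OF vector_fields_at[OF X p]] by simp

lemma D_phi:
  assumes "X \<in> vector_fields M" "Y \<in> vector_fields M"
  shows "D X (\<lambda>q. \<phi> q (Y q)) p = \<phi> p (D X Y p)
     - (g p (\<phi> p (X p)) (\<phi> p (Y p)) *\<^sub>R \<xi> p) - (\<epsilon> * \<eta> p (Y p)) *\<^sub>R \<phi> p (\<phi> p (X p))"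
proof -
  have "cov_deriv_1_1 D \<phi> X Y p =
      - (g p (\<phi> p (X p)) (\<phi> p (Y p)) *\<^sub>R \<xi> p) - (\<epsilon> * \<eta> p (Y p)) *\<^sub>R \<phi> p (\<phi> p (X p))"
    using para_sasakian assms p unfolding eps_para_sasakian_def by (elim conjE) simp
  then show ?thesis
    unfolding cov_deriv_1_1_def by (simp add: algebra_simps)
qed

text \<open>Differentiating \<open>\<phi>\<xi> = 0\<close> determines \<open>\<phi>(\<nabla>\<^sub>X \<xi>)\<close>, hence \<open>\<nabla>\<^sub>X \<xi>\<close> up to a multiple of \<open>\<xi>\<close>;
  that multiple is zero because \<open>g(\<xi>,\<xi>) = \<epsilon>\<close> is constant.\<close>

lemma D_xi:
  assumes X: "X \<in> vector_fields M"
  shows "D X \<xi> p = \<epsilon> *\<^sub>R \<phi> p (X p)"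
proof -
  note Xp = vector_fields_at[OF X p]
  note DX = D_field[OF X xi] and DXp = vector_fields_at[OF D_field[OF X xi] p]
  have "D X (\<lambda>q. \<phi> q (\<xi> q)) p = 0"
  proof (rule affine_connection_zero_on_points[OF manifold _ X phi_field[OF xi] p])
    show "affine_connection M D"
      using levi_civita unfolding levi_civita_def by (elim conjE)
    show "\<phi> q (\<xi> q) = 0" if "q \<in> points M" for q
      using paracontact that unfolding eps_almost_paracontact_metric_def by (elim conjE) simp
  qed
  then have "\<phi> p (D X \<xi> p) = \<epsilon> *\<^sub>R \<phi> p (\<phi> p (X p))"
    using D_phi[OF X xi] g_phi_phi[OF X xi] g_xi[OF X] by (simp add: eta_xi)
  then have "\<phi> p (\<phi> p (D X \<xi> p)) = \<epsilon> *\<^sub>R \<phi> p (X p)"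
    using Xp by (simp add: phi_scale phi_tangent phi_phi_phi)
  moreover have "\<eta> p (D X \<xi> p) = 0"
  proof -
    have "X p (\<lambda>q. g q (\<xi> q) (\<xi> q)) = X p (\<lambda>q. \<epsilon>)"
    proof (rule tangent_vector_cong[OF manifold Xp p])
      show "g q (\<xi> q) (\<xi> q) = \<epsilon>" if "q \<in> points M" for q
        using eps_para_sasakian_manifold.g_xi[OF eps_para_sasakian_manifold_axioms that xi]
          eps_para_sasakian_manifold.eta_xi[OF eps_para_sasakian_manifold_axioms that] by simp
    qed
    then have "2 * g p (D X \<xi> p) (\<xi> p) = 0"
      using D_metric[OF X xi xi p] g_sym[OF p xi_tangent DXp] tangent_vector_const[OF manifold Xp]
      by simp
    then show ?thesis
      using g_xi[OF DX] eps_cases by auto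
  qed
  ultimately show ?thesis
    using phi_phi[OF DXp] by simp
qed

text \<open>Writing the brackets through the torsion-free connection, the terms \<open>\<nabla>\<^sub>\<xi> X\<close> and \<open>\<nabla>\<^sub>\<xi> Y\<close>
  cancel by metricity, and \<open>g(\<nabla>\<^sub>X \<xi>,Y) + g(X,\<nabla>\<^sub>Y \<xi>)\<close> remains.\<close>

lemma lie_derivative_xi:
  assumes X: "X \<in> vector_fields M" and Y: "Y \<in> vector_fields M"
  shows "lie_derivative \<xi> g X Y p = 2 * \<epsilon> * g p (\<phi> p (X p)) (Y p)"
proof -
  note tan = vector_fields_at[OF X p] vector_fields_at[OF Y p]
    vector_fields_at[OF D_field[OF xi X] p] vector_fields_at[OF D_field[OF xi Y] p]
  have "g p (bracket \<xi> X p) (Y p) = g p (D \<xi> X p) (Y p) - \<epsilon> * g p (\<phi> p (X p)) (Y p)"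
    using tan by (simp add: D_torsion_free[OF xi X p] D_xi[OF X] g_diff_left g_scale_left
        tangent_closed phi_tangent)
  moreover have "g p (X p) (bracket \<xi> Y p) = g p (X p) (D \<xi> Y p) - \<epsilon> * g p (X p) (\<phi> p (Y p))"
    using tan by (simp add: D_torsion_free[OF xi Y p] D_xi[OF Y] g_diff_right g_scale_left
        tangent_closed phi_tangent g_sym[OF p, of "X p"])
  ultimately show ?thesis
    using D_metric[OF xi X Y p] g_phi_swap[OF X Y] unfolding lie_derivative_def by simp
qed

end

section \<open>The derivative of the soliton tensor\<close>

text \<open>The tensor \<open>F\<close> of the introduction. With \<open>A = \<epsilon> + b\<close> and \<open>C = \<epsilon> (c + \<mu>)\<close> it is the left-hand
  side of the soliton equation for \<open>\<lambda> = -(a + C)\<close>.\<close>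

definition defect :: "real \<Rightarrow> real \<Rightarrow> 'm vfield \<Rightarrow> 'm vfield \<Rightarrow> 'm \<Rightarrow> real" where
  "defect A C X Y = (\<lambda>p. A * g p (\<phi> p (X p)) (Y p) - C * g p (\<phi> p (X p)) (\<phi> p (Y p)))"

text \<open>By the formula for \<open>\<nabla>\<phi>\<close>, the derivative of \<open>g(\<phi>Y,Z)\<close> consists of terms
  \<open>\<eta>(Z) g(\<phi>X,\<phi>Y)\<close> and that of \<open>g(\<phi>Y,\<phi>Z)\<close> of terms \<open>\<eta>(Z) g(\<phi>X,Y)\<close>: the two tensors are
  exchanged, which is also the effect of replacing \<open>Y\<close> by \<open>\<phi>Y\<close>. The metric term has derivative
  zero.\<close>

lemma cov_deriv_defect_plus_metric:
  assumes \<beta>: "\<And>Y Z q. \<lbrakk>Y \<in> vector_fields M; Z \<in> vector_fields M; q \<in> points M\<rbrakk> \<Longrightarrow>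
       \<beta> Y Z q = defect A C Y Z q + B * g q (Y q) (Z q)"
    and X: "X \<in> vector_fields M" and Y: "Y \<in> vector_fields M" and Z: "Z \<in> vector_fields M"
    and p: "p \<in> points M"
  shows "cov_deriv_0_2 D \<beta> X Y Z p =
    - \<epsilon> * (\<eta> p (Z p) * defect A C X (\<lambda>q. \<phi> q (Y q)) p + \<eta> p (Y p) * defect A C X (\<lambda>q. \<phi> q (Z q)) p)"
proof -
  note Xp = vector_fields_at[OF X p] and Yp = vector_fields_at[OF Y p]
    and Zp = vector_fields_at[OF Z p]
  note DY = D_field[OF X Y] and DZ = D_field[OF X Z]
  note DYp = vector_fields_at[OF DY p] and DZp = vector_fields_at[OF DZ p]
  let ?\<phi>Y = "\<lambda>q. \<phi> q (Y q)" and ?\<phi>Z = "\<lambda>q. \<phi> q (Z q)"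
  note sm = g_smooth[OF phi_field[OF Y] Z] g_smooth[OF Y Z]
    g_smooth[OF phi_field[OF Y] phi_field[OF Z]]
  have "X p (\<beta> Y Z) = X p (\<lambda>q. (A * g q (?\<phi>Y q) (Z q) + B * g q (Y q) (Z q))
      + (- C) * g q (?\<phi>Y q) (?\<phi>Z q))"
    by (rule tangent_vector_cong[OF manifold Xp p]) (simp add: \<beta>[OF Y Z] defect_def)
  also have "\<dots> = A * X p (\<lambda>q. g q (?\<phi>Y q) (Z q)) + B * X p (\<lambda>q. g q (Y q) (Z q))
      - C * X p (\<lambda>q. g q (?\<phi>Y q) (?\<phi>Z q))"
    using sm by (simp only: tangent_vector_add[OF Xp] tangent_vector_mult_const[OF Xp]
        smooth_functions_add smooth_functions_mult_const)
  finally have deriv: "X p (\<beta> Y Z) = A * (g p (D X ?\<phi>Y p) (Z p) + g p (\<phi> p (Y p)) (D X Z p))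
      + B * (g p (D X Y p) (Z p) + g p (Y p) (D X Z p))
      - C * (g p (D X ?\<phi>Y p) (\<phi> p (Z p)) + g p (\<phi> p (Y p)) (D X ?\<phi>Z p))"
    by (simp add: D_metric[OF X _ _ p] phi_field Y Z)

  have D_phi_inner: "g p (D X (\<lambda>q. \<phi> q (V q)) p) (W p) = g p (\<phi> p (D X V p)) (W p)
      - \<epsilon> * (g p (\<phi> p (X p)) (\<phi> p (V p)) * \<eta> p (W p))
      - \<epsilon> * (\<eta> p (V p) * g p (\<phi> p (X p)) (\<phi> p (W p)))"
    if V: "V \<in> vector_fields M" and W: "W \<in> vector_fields M" for V W
  proof -
    note Wp = vector_fields_at[OF W p] and DVp = vector_fields_at[OF D_field[OF X V] p]
    have "g p (\<xi> p) (W p) = \<epsilon> * \<eta> p (W p)"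
      using g_xi[OF p W] g_sym[OF p Wp xi_tangent[OF p]] by simp
    moreover have "g p (\<phi> p (\<phi> p (X p))) (W p) = g p (\<phi> p (X p)) (\<phi> p (W p))"
      using g_phi_swap[OF p phi_field[OF X] W] by simp
    ultimately show ?thesis
      using Xp Wp DVp
      by (simp add: D_phi[OF p X V] g_diff_left[OF p] g_scale_left[OF p] tangent_closed[OF p]
          phi_tangent[OF p] xi_tangent[OF p])
  qed
  have 1: "g p (D X ?\<phi>Y p) (Z p) = g p (\<phi> p (D X Y p)) (Z p)
      - \<epsilon> * (g p (\<phi> p (X p)) (\<phi> p (Y p)) * \<eta> p (Z p))
      - \<epsilon> * (\<eta> p (Y p) * g p (\<phi> p (X p)) (\<phi> p (Z p)))"
    by (rule D_phi_inner[OF Y Z])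
  have 2: "g p (D X ?\<phi>Y p) (\<phi> p (Z p)) = g p (\<phi> p (D X Y p)) (\<phi> p (Z p))
      - \<epsilon> * (\<eta> p (Y p) * g p (\<phi> p (X p)) (Z p))"
    using D_phi_inner[OF Y phi_field[OF Z]] by (simp add: eta_phi[OF p Zp] g_phi_phi_phi[OF p X Z])
  have 3: "g p (\<phi> p (Y p)) (D X ?\<phi>Z p) = g p (\<phi> p (Y p)) (\<phi> p (D X Z p))
      - \<epsilon> * (\<eta> p (Z p) * g p (\<phi> p (X p)) (Y p))"
    using D_phi_inner[OF Z phi_field[OF Y]]
      g_sym[OF p phi_tangent[OF p Yp] vector_fields_at[OF D_field[OF X phi_field[OF Z]] p]]
      g_sym[OF p phi_tangent[OF p Yp] phi_tangent[OF p DZp]]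
    by (simp add: eta_phi[OF p Yp] g_phi_phi_phi[OF p X Y])
  show ?thesis
    unfolding cov_deriv_0_2_def deriv 1 2 3 \<beta>[OF DY Z p] \<beta>[OF Y DZ p] defect_def
    by (simp add: g_phi_phi_phi[OF p X Y] g_phi_phi_phi[OF p X Z] algebra_simps)
qed

lemma defect_phi_phi:
  assumes "X \<in> vector_fields M" "Y \<in> vector_fields M" "p \<in> points M"
  shows "defect A C X (\<lambda>q. \<phi> q (\<phi> q (Y q))) p = defect A C X Y p"
  using assms by (simp add: defect_def g_phi_phi_phi phi_phi_phi[OF _ vector_fields_at])

lemma parallel_iff_defect_zero:
  assumes \<beta>: "\<And>Y Z q. \<lbrakk>Y \<in> vector_fields M; Z \<in> vector_fields M; q \<in> points M\<rbrakk> \<Longrightarrow>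
       \<beta> Y Z q = defect A C Y Z q + B * g q (Y q) (Z q)"
  shows "parallel M D \<beta> \<longleftrightarrow>
    (\<forall>X\<in>vector_fields M. \<forall>Y\<in>vector_fields M. \<forall>p\<in>points M. defect A C X Y p = 0)"
proof
  assume par: "parallel M D \<beta>"
  show "\<forall>X\<in>vector_fields M. \<forall>Y\<in>vector_fields M. \<forall>p\<in>points M. defect A C X Y p = 0"
  proof (intro ballI)
    fix X Y p
    assume X: "X \<in> vector_fields M" and Y: "Y \<in> vector_fields M" and p: "p \<in> points M"
    let ?\<phi>Y = "\<lambda>q. \<phi> q (Y q)"
    \<comment> \<open>With \<open>\<phi>Y\<close> and \<open>\<xi>\<close> as arguments one summand vanishes by \<open>\<eta>(\<phi>Y) = 0\<close>, the other is \<open>F(X,\<phi>\<^sup>2Y)\<close>.\<close>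
    have "cov_deriv_0_2 D \<beta> X ?\<phi>Y \<xi> p = - \<epsilon> * defect A C X Y p"
      by (simp add: cov_deriv_defect_plus_metric[OF \<beta> X phi_field[OF Y] xi p]
          defect_phi_phi[OF X Y p] eta_xi[OF p] eta_phi[OF p vector_fields_at[OF Y p]])
    then show "defect A C X Y p = 0"
      using par X phi_field[OF Y] xi p eps_cases unfolding parallel_def by fastforce
  qed
next
  assume "\<forall>X\<in>vector_fields M. \<forall>Y\<in>vector_fields M. \<forall>p\<in>points M. defect A C X Y p = 0"
  then show "parallel M D \<beta>"
    unfolding parallel_def by (simp add: cov_deriv_defect_plus_metric[OF \<beta>] phi_field)
qed

end

section \<open>Parallelism and the soliton equation\<close>

theorem theorem5p8:
  fixes M :: "('m, 'e::euclidean_space) mfd"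
    and \<phi> :: "'m \<Rightarrow> 'm tvec \<Rightarrow> 'm tvec" and \<xi> :: "'m vfield" and \<eta> :: "'m \<Rightarrow> 'm tvec \<Rightarrow> real"
    and g :: "'m \<Rightarrow> 'm tvec \<Rightarrow> 'm tvec \<Rightarrow> real" and D :: "'m connection"
    and \<epsilon> a b c \<mu> :: real
    and \<alpha> :: "'m vfield \<Rightarrow> 'm vfield \<Rightarrow> 'm \<Rightarrow> real"
  assumes "smooth_manifold M"
    and "eps_para_sasakian M \<phi> \<xi> \<eta> g \<epsilon> D"
    and "einstein_like M \<phi> \<eta> g D a b c"
    and "\<alpha> = (\<lambda>X Y p. 1/2 * lie_derivative \<xi> g X Y p + ricci M D X Y p
                        + \<mu> * \<eta> p (X p) * \<eta> p (Y p))"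
  shows "parallel M D \<alpha> \<longleftrightarrow> eta_ricci_soliton M \<eta> D g \<xi> (- (a + \<epsilon> * (c + \<mu>))) \<mu>"
proof -
  interpret eps_para_sasakian_manifold M \<phi> \<xi> \<eta> g D \<epsilon>
    using assms(1,2) by unfold_locales
  let ?C = "\<epsilon> * (c + \<mu>)"
  have \<alpha>: "\<alpha> X Y p = defect (\<epsilon> + b) ?C X Y p + (a + ?C) * g p (X p) (Y p)"
    if X: "X \<in> vector_fields M" and Y: "Y \<in> vector_fields M" and p: "p \<in> points M" for X Y p
  proof -
    have "ricci M D X Y p = a * g p (X p) (Y p) + b * g p (\<phi> p (X p)) (Y p)
        + c * \<eta> p (X p) * \<eta> p (Y p)"
      using assms(3) X Y p unfolding einstein_like_def by blast
    \<comment> \<open>\<open>g_phi_phi\<close> trades \<open>\<eta> \<otimes> \<eta>\<close> for \<open>\<epsilon> (g - g(\<phi>\<cdot>,\<phi>\<cdot>))\<close>.\<close>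
    then show ?thesis
      unfolding assms(4) defect_def
      by (simp add: lie_derivative_xi[OF p X Y] g_phi_phi[OF p X Y] algebra_simps)
  qed
  have "eta_ricci_soliton M \<eta> D g \<xi> (- (a + ?C)) \<mu> \<longleftrightarrow>
    (\<forall>X\<in>vector_fields M. \<forall>Y\<in>vector_fields M. \<forall>p\<in>points M.
       \<alpha> X Y p - (a + ?C) * g p (X p) (Y p) = 0)"
    unfolding eta_ricci_soliton_def assms(4) by (simp add: algebra_simps)
  also have "\<dots> \<longleftrightarrow> (\<forall>X\<in>vector_fields M. \<forall>Y\<in>vector_fields M. \<forall>p\<in>points M.
       defect (\<epsilon> + b) ?C X Y p = 0)"
    by (simp add: \<alpha>)
  also have "\<dots> \<longleftrightarrow> parallel M D \<alpha>"
    using parallel_iff_defect_zero[OF \<alpha>] by blast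
  finally show ?thesis by blast
qed

end
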